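(* Let $B\in\{1,\dots,9\}$, let $\tilde p<0$ be an integer and $\tilde q$ a positive integer with $\tilde q\geqslant 3600\sqrt[3]{|\tilde p|}$. Then the equation $\tilde Q(t)=0$ has five simple roots satisfying the condition ($t>0$ if $t$ is real, $\operatorname{Im}t>0$ if $t$ is non-real). Three of them are real and positive, and these three positive real roots lie in the three pairwise disjoint intervals $$F_1+\tfrac{10\tilde p}{B^{2}\tilde q^{3}}<t<F_1,\qquad F_2<t<F_2-\tfrac{10\tilde p}{B^{2}\tilde q^{3}},\qquad F_3+\tfrac{32\tilde p}{B^{2}\tilde q^{3}}<t<F_3,$$ respectively, where $F_1=B^{2}\tilde q^{6}+2B\tilde q^{4}-2B\tilde p\tilde q^{3}-2\tilde q^{2}-2\tilde p\tilde q+\tilde p^{2}+\frac5B-\frac{20}{B^{2}\tilde q^{2}}$, $F_2=B^{2}\tilde q^{6}-2B\tilde q^{4}-2B\tilde p\tilde q^{3}-2\tilde q^{2}+2\tilde p\tilde q+\tilde p^{2}-\frac5B-\frac{20}{B^{2}\tilde q^{2}}$, $F_3=B\tilde q^{4}-\tilde p\tilde q+\frac{16}{B}$.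
   Context: For numbers $p,q$ let $$Q_{pq}(t)=t^{10}+(2q^{2}+p^{2})(3q^{2}-2p^{2})\,t^{8}+(q^{8}+10p^{2}q^{6}+4p^{4}q^{4}-14p^{6}q^{2}+p^{8})\,t^{6}-p^{2}q^{2}(q^{8}-14p^{2}q^{6}+4p^{4}q^{4}+10p^{6}q^{2}+p^{8})\,t^{4}-p^{6}q^{6}(q^{2}+2p^{2})(3p^{2}-2q^{2})\,t^{2}-q^{10}p^{10}.$$ Given $B$, $\tilde p$, $\tilde q$, define $\tilde Q(t)=Q_{pq}(t)$ with $p=B\tilde q^{3}-\tilde p$ and $q=\tilde q$. *)

theory Defs
  imports Complex_Main "HOL-Computational_Algebra.Polynomial"
begin

definition Q_poly :: "'a::comm_ring_1 \<Rightarrow> 'a \<Rightarrow> 'a poly" where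
  "Q_poly p q =
     monom 1 10
   + monom ((2*q^2 + p^2) * (3*q^2 - 2*p^2)) 8
   + monom (q^8 + 10*p^2*q^6 + 4*p^4*q^4 - 14*p^6*q^2 + p^8) 6
   - monom (p^2*q^2 * (q^8 - 14*p^2*q^6 + 4*p^4*q^4 + 10*p^6*q^2 + p^8)) 4
   - monom (p^6*q^6 * (q^2 + 2*p^2) * (3*p^2 - 2*q^2)) 2
   - monom (q^10 * p^10) 0"

definition Q_tilde :: "'a::comm_ring_1 \<Rightarrow> 'a \<Rightarrow> 'a \<Rightarrow> 'a poly" where
  "Q_tilde B p' q' = Q_poly (B * q'^3 - p') q'"

definition root_condition :: "complex \<Rightarrow> bool" where
  "root_condition t \<longleftrightarrow> (if t \<in> \<real> then Re t > 0 else Im t > 0)"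

definition F1 :: "real \<Rightarrow> real \<Rightarrow> real \<Rightarrow> real" where
  "F1 B p q = B^2*q^6 + 2*B*q^4 - 2*B*p*q^3 - 2*q^2 - 2*p*q + p^2 + 5/B - 20/(B^2*q^2)"

definition F2 :: "real \<Rightarrow> real \<Rightarrow> real \<Rightarrow> real" where
  "F2 B p q = B^2*q^6 - 2*B*q^4 - 2*B*p*q^3 - 2*q^2 + 2*p*q + p^2 - 5/B - 20/(B^2*q^2)"

definition F3 :: "real \<Rightarrow> real \<Rightarrow> real \<Rightarrow> real" where
  "F3 B p q = B*q^4 - p*q + 16/B"

text \<open>The intervals are nonempty because they are used only with \<open>p < 0 < q\<close>.\<close>

definition I1 :: "real \<Rightarrow> real \<Rightarrow> real \<Rightarrow> real set" where
  "I1 B p q = {F1 B p q + 10*p/(B^2*q^3) <..< F1 B p q}"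

definition I2 :: "real \<Rightarrow> real \<Rightarrow> real \<Rightarrow> real set" where
  "I2 B p q = {F2 B p q <..< F2 B p q - 10*p/(B^2*q^3)}"

definition I3 :: "real \<Rightarrow> real \<Rightarrow> real \<Rightarrow> real set" where
  "I3 B p q = {F3 B p q + 32*p/(B^2*q^3) <..< F3 B p q}"

end

theory Submission
  imports Defs
begin

text \<open>
  \<open>Q\<^sub>p\<^sub>q\<close> is a quintic in \<open>s = t\<^sup>2\<close>, homogeneous of degree 20 when \<open>t\<close> has weight 2, so with
  \<open>x = q/p\<close> it equals \<open>p\<^sup>2\<^sup>0\<close> times a quintic in \<open>t\<^sup>2/p\<^sup>4\<close> depending only on \<open>x\<close>. For small \<open>x\<close> the
  roots of the latter are real: two near \<open>(1 \<plusminus> 2x - 2x\<^sup>2 \<plusminus> 5x\<^sup>3 - 20x\<^sup>4)\<^sup>2\<close>, one near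
  \<open>(x + 16x\<^sup>3)\<^sup>2\<close>, and two negative ones near \<open>(-3 \<plusminus> 2\<surd>2) x\<^sup>4\<close>. They are isolated by sign changes.
  With \<open>w = -p'/(B q\<^sup>3)\<close>, where \<open>p = B q\<^sup>3 - p'\<close>, the endpoints of the three intervals deviate from
  the expansions by about \<open>\<plusminus>5w x\<^sup>3\<close> or \<open>\<plusminus>16w x\<^sup>3\<close>, which dominates the next
  term of the expansion, of order \<open>x\<^sup>5\<close>, because \<open>x\<^sup>2\<close> is much smaller than \<open>w\<close>.
\<close>

section \<open>The quintic in \<open>s = t^2\<close>: degree and homogeneity\<close>

definition quintic :: "'a::comm_ring_1 \<Rightarrow> 'a \<Rightarrow> 'a \<Rightarrow> 'a" where
  "quintic p q s =
     s^5
   + (2*q^2 + p^2) * (3*q^2 - 2*p^2) * s^4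
   + (q^8 + 10*p^2*q^6 + 4*p^4*q^4 - 14*p^6*q^2 + p^8) * s^3
   - p^2*q^2 * (q^8 - 14*p^2*q^6 + 4*p^4*q^4 + 10*p^6*q^2 + p^8) * s^2
   - p^6*q^6 * (q^2 + 2*p^2) * (3*p^2 - 2*q^2) * s
   - q^10 * p^10"

lemma poly_Q_poly: "poly (Q_poly p q) t = quintic p q (t^2)"
  by (simp add: Q_poly_def quintic_def poly_monom flip: power_mult)

lemma degree_Q_poly: "degree (Q_poly p q :: 'a::comm_ring_1 poly) = 10"
proof (rule antisym)
  show "degree (Q_poly p q) \<le> 10"
    unfolding Q_poly_def
    by (intro degree_diff_le degree_add_le order.trans[OF degree_monom_le]) simp_all
  show "10 \<le> degree (Q_poly p q)"
    by (rule le_degree) (simp add: Q_poly_def)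
qed

lemma of_real_quintic:
  "quintic (of_real p) (of_real q) (of_real s) = (of_real (quintic p q s) :: complex)"
  by (simp add: quintic_def)

lemma quintic_homogeneous:
  fixes p x s :: real
  shows "quintic p (p * x) (p^4 * s) = p^20 * quintic 1 x s"
  unfolding quintic_def power_one mult_1_left mult_1_right by algebra

section \<open>Residuals of the quintic near its approximate roots\<close>

text \<open>One Horner step of a polynomial bound. Applied repeatedly, it builds the bound of a
  nested polynomial by unification, so that only a numerical inequality remains for
  \<open>simp\<close>.\<close>

lemma abs_horner_le:
  fixes a b x :: real
  assumes "\<bar>a\<bar> \<le> \<alpha>" "\<bar>b\<bar> \<le> \<beta>" "\<bar>x\<bar> \<le> \<epsilon>"
  shows "\<bar>a + x * b\<bar> \<le> \<alpha> + \<epsilon> * \<beta>"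
proof -
  have "\<bar>x * b\<bar> \<le> \<epsilon> * \<beta>"
    unfolding abs_mult using assms by (intro mult_mono) auto
  then show ?thesis
    using assms(1) abs_triangle_ineq[of a "x * b"] by linarith
qed

text \<open>At \<open>x = 0\<close> the quintic is \<open>s^3 * (s - 1)^2\<close>. For small
  \<open>x\<close> the double root splits into roots near \<open>1 + 4*x\<close> and
  \<open>1 - 4*x\<close>, so the slope at the first is about their gap \<open>8*x\<close>. Hence a
  displacement \<open>z * x^3\<close> changes the value by about \<open>8 * z * x^4\<close>, while
  the truncation itself leaves only a residual of order \<open>x^6\<close>.\<close>

lemma quintic_near_one:
  fixes x z :: real
  assumes x: "\<bar>x\<bar> \<le> 1/1000" and z: "\<bar>z\<bar> \<le> 1"
  obtains d a where "\<bar>d\<bar> \<le> 1" "\<bar>a\<bar> \<le> 500"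
    "quintic 1 x (1 + 4*x + (2 - 16*x + z) * x^3) = x^4 * (z * (8 + d) + x^2 * a)"
proof -
  \<comment> \<open>The expanded quintic is split into the part free of \<open>z\<close> and a
    multiple of \<open>z\<close>. Both are nested, in \<open>x\<close> outside and in
    \<open>z\<close> inside, to fit \<open>abs_horner_le\<close>; factors such as \<open>z*1\<close>
    keep that shape.\<close>
  define a where "a =
      -428 + x*(-3216 + x*(-5940 + x*(-1640 + x*(15624 + x*(83312 + x*(-7784 + x*(69472 +
      x*(-456924 + x*(145120 + x*(-431652 + x*(986184 + x*(-233920 + x*(460288 +
      x*(-659456))))))))))))))"
  define d where "d =
      96 + x*((380 + z*1) + x*((544 + z*36) + x*((-148 + z*239) + x*((-4556 + z*(442 +
      z*3)) + x*((-12056 + z*(86 + z*48)) + x*((-1496 + z*(-1116 + z*142)) + x*((1296 +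
      z*(-6238 + z*(8 + z*3))) + x*((92064 + z*(384 + z*(-4 + z*20))) + x*((-17252 +
      z*(-3847 + z*(-1192 + z*(-1)))) + x*((77272 + z*(26648 + z*(114 + z*(10 + z*1)))) +
      x*((-264772 + z*(-3793 + z*(-592 + z*(-74)))) + x*((50220 + z*(13062 + z*2177)) +
      x*((-127168 + z*(-31792)) + x*230144)))))))))))))"
  have "quintic 1 x (1 + 4*x + (2 - 16*x + z) * x^3) = x^4 * (z * (8 + x*d) + x^2 * a)"
    unfolding quintic_def a_def d_def power_one mult_1_left mult_1_right by algebra
  moreover have "\<bar>a\<bar> \<le> 500"
    unfolding a_def by (rule order_trans, (rule abs_horner_le x order_refl)+) simp
  moreover have "\<bar>d\<bar> \<le> 100"
    unfolding d_def by (rule order_trans, (rule abs_horner_le x z order_refl)+) simp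
  then have "\<bar>x * d\<bar> \<le> 1/1000 * 100"
    unfolding abs_mult using x by (intro mult_mono) auto
  ultimately show ?thesis
    by (intro that[of "x * d" a]) auto
qed

text \<open>The slope at the root near \<open>x^2\<close> is about \<open>x^4\<close>: its distances
  to the two negative roots of order \<open>x^4\<close> are about \<open>x^2\<close> each, and those
  to the two roots near 1 have product about 1.\<close>

lemma quintic_near_square:
  fixes x z :: real
  assumes x: "\<bar>x\<bar> \<le> 1/1000" and z: "\<bar>z\<bar> \<le> 1"
  obtains d a where "\<bar>d\<bar> \<le> 1/2" "\<bar>a\<bar> \<le> 500"
    "quintic 1 x (x^2 * (1 + (32 + z) * x^2)) = x^8 * (z * (1 + d) + x^2 * a)"
proof -
  have x2: "\<bar>x^2\<bar> \<le> 1/1000000"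
    using power_mono[OF x, of 2] by (simp add: power2_eq_square)
  define a where "a =
      -384 + x^2*(-32544 + x^2*(-705920 + x^2*(-1687520 + x^2*(5310464 + x^2*39878656))))"
  define d where "d =
      (52 + z*2) + x^2*((-1018 + z*(32 + z*1)) + x^2*((-66732 + z*(-2100 + z*(-22))) +
      x^2*((-226303 + z*(-11248 + z*(-246 + z*(-2)))) + x^2*((628864 + z*(27842 + z*(546 +
      z*4))) + x^2*((6032384 + z*(364640 + z*(11009 + z*(166 + z*1)))))))))"
  have "quintic 1 x (x^2 * (1 + (32 + z) * x^2)) = x^8 * (z * (1 + x^2*d) + x^2 * a)"
    unfolding quintic_def a_def d_def power_one mult_1_left mult_1_right by algebra
  moreover have "\<bar>a\<bar> \<le> 500"
    unfolding a_def by (rule order_trans, (rule abs_horner_le x2 order_refl)+) simp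
  moreover have "\<bar>d\<bar> \<le> 100"
    unfolding d_def by (rule order_trans, (rule abs_horner_le x2 z order_refl)+) simp
  then have "\<bar>x^2 * d\<bar> \<le> 1/1000000 * 100"
    unfolding abs_mult using x2 by (intro mult_mono) auto
  ultimately show ?thesis
    by (intro that[of "x^2 * d" a]) auto
qed


section \<open>Signs of the quintic at perturbed expansions\<close>

text \<open>Truncated root expansions in \<open>x\<close>, perturbed by \<open>y x\<^sup>3\<close>. The roots near \<open>1\<close> are interchanged
  by \<open>x \<mapsto> -x\<close>.\<close>

definition root_one :: "real \<Rightarrow> real \<Rightarrow> real" where
  "root_one x y = 1 + 2*x - 2*x^2 + (5 - 20*x + y) * x^3"

definition root_zero :: "real \<Rightarrow> real \<Rightarrow> real" where
  "root_zero x y = x + (16 + y) * x^3"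

text \<open>Squaring turns the perturbation \<open>y\<close> into \<open>z\<close>, which is
  \<open>2*y\<close> up to \<open>101 * x^2 + \<bar>y\<bar> / 100\<close>. Once \<open>y\<close>
  exceeds a suitable multiple of \<open>x^2\<close> in size, its sign decides that of the quintic by
  \<open>quintic_near_one\<close>.\<close>

lemma quintic_root_one_sign:
  assumes x: "\<bar>x\<bar> \<le> 1/1000" "x \<noteq> 0" and y: "\<bar>y\<bar> \<le> 1/10"
  shows "y \<ge> 200 * x^2 \<Longrightarrow> quintic 1 x ((root_one x y)^2) > 0"
    and "y \<le> -200 * x^2 \<Longrightarrow> quintic 1 x ((root_one x y)^2) < 0"
proof -
  define r where "r = 5 - 20*x + y"
  define e where "e = 4*x - 4*x^2"
  define z where "z = y * (2 + e) - 100 * x^2 + x^2 * (x * (80 + r^2))"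
  have sq: "(root_one x y)^2 = 1 + 4*x + (2 - 16*x + z) * x^3"
    unfolding root_one_def z_def e_def r_def by algebra
  have x2: "0 < x^2" "x^2 \<le> 1/1000000"
    using x power_mono[of "\<bar>x\<bar>" "1/1000" 2] by (auto simp: power_divide)
  have e: "\<bar>e\<bar> \<le> 1/100" using x x2 unfolding e_def by linarith
  have "\<bar>r\<bar> \<le> 6" using x y unfolding r_def by linarith
  then have "r^2 \<le> 36" using power_mono[of "\<bar>r\<bar>" 6 2] by simp
  then have "\<bar>x * (80 + r^2)\<bar> \<le> 1/1000 * 116"
    unfolding abs_mult using x by (intro mult_mono) auto
  then have "\<bar>x^2 * (x * (80 + r^2))\<bar> \<le> x^2 * 1"
    unfolding abs_mult by (intro mult_mono) auto
  then have rem: "\<bar>z - y * (2 + e)\<bar> \<le> 101 * x^2"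
    unfolding z_def using x2 by linarith
  have "\<bar>y * e\<bar> \<le> \<bar>y\<bar> * (1/100)"
    unfolding abs_mult using e by (intro mult_left_mono) auto
  with rem have z: "\<bar>z - 2 * y\<bar> \<le> 101 * x^2 + \<bar>y\<bar> / 100"
    by (simp add: distrib_left)
  then have "\<bar>z\<bar> \<le> 1" using y x2 by linarith
  from quintic_near_one[OF x(1) this] obtain d a where da: "\<bar>d\<bar> \<le> 1" "\<bar>a\<bar> \<le> 500"
    "quintic 1 x ((root_one x y)^2) = x^4 * (z * (8 + d) + x^2 * a)"
    unfolding sq by metis
  have xa: "\<bar>x^2 * a\<bar> \<le> x^2 * 500"
    unfolding abs_mult using da by (intro mult_mono) auto
  have x4: "x^4 > 0" using x by simp
  show "quintic 1 x ((root_one x y)^2) > 0" if "y \<ge> 200 * x^2"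
  proof -
    \<comment> \<open>The threshold 200 gives at least \<open>(398 - 2 - 101) * x^2\<close> for
      \<open>z\<close>, and \<open>7 * 250\<close> outweighs the bound 500 on the residual.\<close>
    have zl: "z \<ge> 250 * x^2" using z that x2 by linarith
    then have "z * (8 + d) \<ge> z * 7" using da x2 by (intro mult_left_mono) linarith+
    then have "z * (8 + d) + x^2 * a > 0" using xa zl x2 by linarith
    then show ?thesis using da(3) x4 by simp
  qed
  show "quintic 1 x ((root_one x y)^2) < 0" if "y \<le> -200 * x^2"
  proof -
    have zl: "z \<le> - 250 * x^2" using z that x2 by linarith
    then have "z * (8 + d) \<le> z * 7" using da x2 by (intro mult_left_mono_neg) linarith+
    then have "z * (8 + d) + x^2 * a < 0" using xa zl x2 by linarith
    then show ?thesis using da(3) x4 by (simp add: mult_less_0_iff)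
  qed
qed

lemma quintic_root_zero_sign:
  assumes x: "\<bar>x\<bar> \<le> 1/1000" "x \<noteq> 0" and y: "\<bar>y\<bar> \<le> 1/10"
  shows "y \<ge> 1000 * x^2 \<Longrightarrow> quintic 1 x ((root_zero x y)^2) > 0"
    and "y \<le> -1000 * x^2 \<Longrightarrow> quintic 1 x ((root_zero x y)^2) < 0"
proof -
  define z where "z = 2 * y + x^2 * (16 + y)^2"
  have sq: "(root_zero x y)^2 = x^2 * (1 + (32 + z) * x^2)"
    unfolding root_zero_def z_def by algebra
  have x2: "0 < x^2" "x^2 \<le> 1/1000000"
    using x power_mono[of "\<bar>x\<bar>" "1/1000" 2] by (auto simp: power_divide)
  have "(16 + y)^2 \<le> 17^2" using y by (intro power_mono) auto
  then have "x^2 * (16 + y)^2 \<le> x^2 * 289" by (intro mult_left_mono) auto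
  then have z: "2 * y \<le> z" "z \<le> 2 * y + 289 * x^2" unfolding z_def by auto
  then have "\<bar>z\<bar> \<le> 1" using y x2 by linarith
  from quintic_near_square[OF x(1) this] obtain d a where da: "\<bar>d\<bar> \<le> 1/2" "\<bar>a\<bar> \<le> 500"
    "quintic 1 x ((root_zero x y)^2) = x^8 * (z * (1 + d) + x^2 * a)"
    unfolding sq by metis
  have xa: "\<bar>x^2 * a\<bar> \<le> x^2 * 500"
    unfolding abs_mult using da by (intro mult_mono) auto
  have x8: "x^8 > 0" using x by simp
  show "quintic 1 x ((root_zero x y)^2) > 0" if "y \<ge> 1000 * x^2"
  proof -
    \<comment> \<open>Here \<open>1500 / 2\<close> has to outweigh the residual bound 500. The
      threshold 1000 also serves the negative case, where up to \<open>289 * x^2\<close> is lost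
      from \<open>2 * y\<close>.\<close>
    have zl: "z \<ge> 1500 * x^2" using z that x2 by linarith
    then have "z * (1 + d) \<ge> z * (1/2)" using da x2 by (intro mult_left_mono) linarith+
    then have "z * (1 + d) + x^2 * a > 0" using xa zl x2 by linarith
    then show ?thesis using da(3) x8 by simp
  qed
  show "quintic 1 x ((root_zero x y)^2) < 0" if "y \<le> -1000 * x^2"
  proof -
    have zl: "z \<le> - 1500 * x^2" using z that x2 by linarith
    then have "z * (1 + d) \<le> z * (1/2)" using da x2 by (intro mult_left_mono_neg) linarith+
    then have "z * (1 + d) + x^2 * a < 0" using xa zl x2 by linarith
    then show ?thesis using da(3) x8 by (simp add: mult_less_0_iff)
  qed
qed

text \<open>At \<open>s = u x\<^sup>4\<close> the leading part of the quintic is \<open>- (u\<^sup>2 + 6u + 1) x\<^sup>1\<^sup>0\<close>, with roots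
  \<open>u = -3 \<plusminus> 2\<surd>2\<close> separated by \<open>-9\<close>, \<open>-1\<close> and \<open>0\<close>.\<close>

lemma quintic_negative_arguments:
  fixes x :: real
  assumes x: "\<bar>x\<bar> \<le> 1/1000" "x \<noteq> 0"
  shows "quintic 1 x (- (x^4)) > 0" and "quintic 1 x (- (9 * x^4)) < 0"
proof -
  have x2: "\<bar>x^2\<bar> \<le> 1/1000000"
    using power_mono[OF x(1), of 2] by (simp add: power2_eq_square)
  have x10: "x^10 > 0" using x by simp
  define a where "a =
      -12 + x^2*(8 + x^2*(8 + x^2*(-12 + x^2*4)))"
  have "quintic 1 x (- (x^4)) = x^10 * (4 + x^2 * a)"
    unfolding quintic_def a_def power_one mult_1_left mult_1_right by algebra
  moreover have "\<bar>a\<bar> \<le> 100"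
    unfolding a_def by (rule order_trans, (rule abs_horner_le x2 order_refl)+) simp
  then have "\<bar>x^2 * a\<bar> \<le> 1/1000000 * 100"
    unfolding abs_mult using x2 by (intro mult_mono) auto
  ultimately show "quintic 1 x (- (x^4)) > 0" using x10 by simp
  define b where "b = -1548 + x^2*(9864 + x^2*(-14904 + x^2*(-13932 + x^2*(-20412))))"
  have "quintic 1 x (- (9 * x^4)) = x^10 * (- 28 + x^2 * b)"
    unfolding quintic_def b_def power_one mult_1_left mult_1_right by algebra
  moreover have "\<bar>b\<bar> \<le> 10000"
    unfolding b_def by (rule order_trans, (rule abs_horner_le x2 order_refl)+) simp
  then have "\<bar>x^2 * b\<bar> \<le> 1/1000000 * 10000"
    unfolding abs_mult using x2 by (intro mult_mono) auto
  ultimately show "quintic 1 x (- (9 * x^4)) < 0" using x10 by (simp add: mult_less_0_iff)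
qed

text \<open>Puts \<open>root_one x y\<close> between \<open>1 + x\<close> and
  \<open>1 + 3*x\<close>, hence on a known side of 1; this separates the first two
  intervals.\<close>

lemma root_one_bounds:
  assumes x: "\<bar>x\<bar> \<le> 1/1000" and y: "\<bar>y\<bar> \<le> 1/10"
  shows "\<bar>root_one x y - 1 - 2*x\<bar> \<le> \<bar>x\<bar>"
proof -
  have "\<bar>x * (5 - 20*x + y)\<bar> \<le> 1/1000 * 6"
    unfolding abs_mult using x y by (intro mult_mono) auto
  then have "\<bar>x * (- 2 + x * (5 - 20*x + y))\<bar> \<le> 1/1000 * 3"
    unfolding abs_mult[of x "- 2 + _"] using x by (intro mult_mono) linarith+
  then have "\<bar>x * (x * (- 2 + x * (5 - 20*x + y)))\<bar> \<le> \<bar>x\<bar> * 1"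
    unfolding abs_mult[of x] by (intro mult_left_mono) auto
  moreover have "root_one x y - 1 - 2*x = x * (x * (- 2 + x * (5 - 20*x + y)))"
    unfolding root_one_def by algebra
  ultimately show ?thesis by simp
qed

lemma root_zero_bounds:
  assumes x: "0 < x" "x \<le> 1/1000" and y: "\<bar>y\<bar> \<le> 1/10"
  shows "0 < root_zero x y" "root_zero x y < 1/2"
proof -
  have x3: "0 < x^3" "x^3 \<le> 1/1000000000"
    using x power_mono[of x "1/1000" 3] by (auto simp: power3_eq_cube)
  then have "0 < (16 + y) * x^3" "(16 + y) * x^3 \<le> 17 * (1/1000000000)"
    using y by (intro mult_pos_pos mult_mono; linarith)+
  then show "0 < root_zero x y" "root_zero x y < 1/2"
    using x unfolding root_zero_def by linarith+
qed

section \<open>From the interval endpoints to the expansions\<close>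

text \<open>Since \<open>P = (1 + w) * (B * q^3)\<close>, the terms \<open>1/B\<close> and
  \<open>1/(B^2*q^2)\<close> equal \<open>x^3 * P^2\<close> and \<open>x^4 * P^2\<close> up to
  factors \<open>1 + w\<close> and \<open>(1 + w)^2\<close>. These factors, and the interval
  lengths, make up the perturbation of each expansion.\<close>

lemma F_eq_scaled:
  fixes B p q :: real
  assumes B: "B \<ge> 1" and p: "p \<le> -1" and q: "q \<ge> 3600" and pq: "1000 * (- p) \<le> q^3"
  defines "P \<equiv> B * q^3 - p"
  obtains x w where "P > 0" "q = P * x" "0 < x" "x \<le> 1/1000" "0 < w" "w \<le> 1/1000"
    "1000 * x^2 \<le> w"
    "F1 B p q = P^2 * root_one x (5*w - 20*(2*w + w^2)*x)"
    "F1 B p q + 10*p/(B^2*q^3) = P^2 * root_one x (- 5*w - 10*w^2 - 20*(2*w + w^2)*x)"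
    "F2 B p q = P^2 * root_one (- x) (5*w + 20*(2*w + w^2)*x)"
    "F2 B p q - 10*p/(B^2*q^3) = P^2 * root_one (- x) (- 5*w - 10*w^2 + 20*(2*w + w^2)*x)"
    "F3 B p q = P^2 * root_zero x (16*w)"
    "F3 B p q + 32*p/(B^2*q^3) = P^2 * root_zero x (- 16*w - 32*w^2)"
proof -
  define x where "x = q / P"
  define w where "w = - p / (B * q^3)"
  have q0: "q > 0" and B0: "B > 0" using B q by auto
  have Bq: "B * q^3 > 0" using q0 B0 by simp
  have P: "P > B * q^3" "P > 0" using p Bq unfolding P_def by auto
  have Px: "q = P * x" using P by (simp add: x_def)
  have x0: "x > 0" using P q0 by (simp add: x_def)
  have w0: "w > 0" using p Bq unfolding w_def by (intro divide_pos_pos) auto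
  have "1 * q^3 \<le> B * q^3" using B q0 by (intro mult_right_mono) auto
  then have w1: "w \<le> 1/1000" using pq Bq by (simp add: w_def field_simps)
  have "x \<le> q / (B * q^3)" unfolding x_def using P Bq q0 by (intro divide_left_mono) auto
  also have "\<dots> = 1 / (B * q^2)" using q0 B0 by (simp add: field_simps power2_eq_square power3_eq_cube)
  finally have xle: "x \<le> 1 / (B * q^2)" .
  have "1 * 1000^2 \<le> B * q^2" using B q by (intro mult_mono power_mono) auto
  then have "1 / (B * q^2) \<le> 1/1000" using q0 B0 by (simp add: field_simps)
  with xle have x1: "x \<le> 1/1000" by simp
  \<comment> \<open>As \<open>-p\<close> is at least 1, \<open>w\<close> is at least
    \<open>1 / (B * q^3)\<close>, which exceeds the bound on \<open>x^2\<close> by the factor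
    \<open>B * q\<close>.\<close>
  have "x^2 \<le> (1 / (B * q^2))^2" using xle x0 by (intro power_mono) auto
  also have "\<dots> = 1 / (B * q^3) / (B * q)"
    using q0 B0 by (simp add: field_simps eval_nat_numeral)
  also have "\<dots> \<le> w / (B * q)"
    unfolding w_def using p q0 B0 by (intro divide_right_mono) auto
  also have "\<dots> \<le> w / 1000"
  proof (rule divide_left_mono)
    show "1000 \<le> B * q" using mult_mono[of 1 B 1000 q] B q by simp
  qed (use w0 B0 q0 in auto)
  finally have x2: "1000 * x^2 \<le> w" by simp
  have Pw: "P = (1 + w) * (B * q^3)"
    using B0 q0 by (simp add: P_def w_def field_simps)
  have invB: "1 / B = (1 + w) * x^3 * P^2"
  proof -
    have "(1 + w) * x^3 * P^2 = (1 + w) * q^3 / P"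
      using P by (simp add: x_def power_divide eval_nat_numeral)
    also have "\<dots> = 1 / B" unfolding Pw using q0 B0 w0 by simp
    finally show ?thesis ..
  qed
  have invB2: "1 / (B^2 * q^2) = (1 + w)^2 * x^4 * P^2"
  proof -
    have "1 / (B^2 * q^2) = (1 / B)^2 / q^2" by (simp add: power_divide)
    also have "\<dots> = (1 + w)^2 * x^4 * P^2"
      unfolding invB Px using P x0 by (simp add: field_simps eval_nat_numeral)
    finally show ?thesis .
  qed
  have "p / (B^2 * q^3) = - w * (1 / B)"
    by (simp add: w_def power2_eq_square)
  then have pB: "p / (B^2 * q^3) = - w * ((1 + w) * x^3 * P^2)"
    unfolding invB .
  have F1: "F1 B p q = P^2 + 2*P*q - 2*q^2 + 5*(1/B) - 20*(1/(B^2*q^2))"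
    unfolding F1_def P_def by (simp add: algebra_simps eval_nat_numeral)
  have F2: "F2 B p q = P^2 - 2*P*q - 2*q^2 - 5*(1/B) - 20*(1/(B^2*q^2))"
    unfolding F2_def P_def by (simp add: algebra_simps eval_nat_numeral)
  have F3: "F3 B p q = P*q + 16*(1/B)"
    unfolding F3_def P_def by (simp add: algebra_simps eval_nat_numeral)
  have c: "c * p / (B^2 * q^3) = - c * w * ((1 + w) * x^3 * P^2)" for c
    using pB by (simp flip: times_divide_eq_right)
  show thesis
  proof (rule that[of x w])
    show "F1 B p q = P^2 * root_one x (5*w - 20*(2*w + w^2)*x)"
      unfolding F1 invB invB2 root_one_def unfolding Px by algebra
    show "F1 B p q + 10*p/(B^2*q^3) = P^2 * root_one x (- 5*w - 10*w^2 - 20*(2*w + w^2)*x)"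
      unfolding F1 c invB invB2 root_one_def unfolding Px by algebra
    show "F2 B p q = P^2 * root_one (- x) (5*w + 20*(2*w + w^2)*x)"
      unfolding F2 invB invB2 root_one_def unfolding Px by algebra
    show "F2 B p q - 10*p/(B^2*q^3) = P^2 * root_one (- x) (- 5*w - 10*w^2 + 20*(2*w + w^2)*x)"
      unfolding F2 c invB invB2 root_one_def unfolding Px by algebra
    show "F3 B p q = P^2 * root_zero x (16*w)"
      unfolding F3 invB root_zero_def unfolding Px by algebra
    show "F3 B p q + 32*p/(B^2*q^3) = P^2 * root_zero x (- 16*w - 32*w^2)"
      unfolding F3 c invB root_zero_def unfolding Px by algebra
  qed (use P Px x0 x1 w0 w1 x2 in auto)
qed

section \<open>Real and purely imaginary roots by sign changes\<close>

lemma Q_tilde_real_and_imaginary_roots: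
  fixes B p q :: real
  assumes B: "B \<ge> 1" and p: "p \<le> -1" and q: "q \<ge> 3600" and pq: "1000 * (- p) \<le> q^3"
  shows "\<exists>t\<in>I1 B p q. poly (Q_tilde B p q) t = 0" (is ?r1)
    and "\<exists>t\<in>I2 B p q. poly (Q_tilde B p q) t = 0" (is ?r2)
    and "\<exists>t\<in>I3 B p q. poly (Q_tilde B p q) t = 0" (is ?r3)
    and "\<exists>r s. 0 < r \<and> r < s \<and> quintic (B * q^3 - p) q (- (r^2)) = 0
           \<and> quintic (B * q^3 - p) q (- (s^2)) = 0" (is ?r4)
    and "\<exists>m>0. I3 B p q \<subseteq> {0<..<m/2} \<and> I2 B p q \<subseteq> {m/2<..<m} \<and> I1 B p q \<subseteq> {m<..}" (is ?r5)
proof -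
  define P where "P = B * q^3 - p"
  obtain x w where P: "P > 0" "q = P * x" and x: "0 < x" "x \<le> 1/1000"
    and w: "0 < w" "w \<le> 1/1000" and xw: "1000 * x^2 \<le> w"
    and F: "F1 B p q = P^2 * root_one x (5*w - 20*(2*w + w^2)*x)"
    "F1 B p q + 10*p/(B^2*q^3) = P^2 * root_one x (- 5*w - 10*w^2 - 20*(2*w + w^2)*x)"
    "F2 B p q = P^2 * root_one (- x) (5*w + 20*(2*w + w^2)*x)"
    "F2 B p q - 10*p/(B^2*q^3) = P^2 * root_one (- x) (- 5*w - 10*w^2 + 20*(2*w + w^2)*x)"
    "F3 B p q = P^2 * root_zero x (16*w)"
    "F3 B p q + 32*p/(B^2*q^3) = P^2 * root_zero x (- 16*w - 32*w^2)"
    using F_eq_scaled[OF B p q pq] unfolding P_def by metis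
  have w2: "0 \<le> w^2" "w^2 \<le> w * (1/1000)"
    using w unfolding power2_eq_square by (auto intro: mult_left_mono)
  have "(2*w + w^2) * x \<le> (3*w) * (1/1000)"
    using w w2 x by (intro mult_mono) auto
  moreover have "0 \<le> (2*w + w^2) * x" using w x by simp
  ultimately have wx: "0 \<le> 20*(2*w + w^2)*x" "20*(2*w + w^2)*x \<le> w * (6/100)"
    unfolding mult.assoc by linarith+
  \<comment> \<open>With these facts each perturbation has the sign of its leading term,
    \<open>5*w\<close> or \<open>16*w\<close> up to sign, and clears the thresholds
    \<open>200 * x^2\<close> and \<open>1000 * x^2\<close>, while staying below 1/10 in
    size.\<close>
  note y_bounds = w w2 wx xw power2_minus[of x]
  have x': "\<bar>x\<bar> \<le> 1/1000" "x \<noteq> 0" "\<bar>-x\<bar> \<le> 1/1000" "-x \<noteq> 0" using x by auto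
  have scale: "quintic P q (P^4 * s) = P^20 * quintic 1 x s" for s
    unfolding P(2) by (rule quintic_homogeneous)
  have ev: "poly (Q_tilde B p q) (P^2 * t) = P^20 * quintic 1 x (t^2)" for t
    using scale[of "t^2"]
    by (simp add: Q_tilde_def poly_Q_poly P_def[symmetric] power_mult_distrib flip: power_mult)
  \<comment> \<open>Only even powers of \<open>q\<close> occur, so the sign lemma applies at
    \<open>- x\<close>, where the endpoints of the second interval are expanded.\<close>
  have even: "quintic 1 (- x) s = quintic 1 x s" for s
    by (simp add: quintic_def)
  have P20: "P^20 > 0" and P2: "P^2 > 0" using P by auto
  have pos: "poly (Q_tilde B p q) (P^2 * t) > 0" if "quintic 1 x (t^2) > 0" for t
    unfolding ev using that P20 by simp
  have neg: "poly (Q_tilde B p q) (P^2 * t) < 0" if "quintic 1 x (t^2) < 0" for t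
    unfolding ev using that P20 by (simp add: mult_less_0_iff)
  have "p / (B^2 * q^3) < 0" using p q B by (simp add: divide_neg_pos)
  then have len: "10*p/(B^2*q^3) < 0" "32*p/(B^2*q^3) < 0"
    by (simp_all flip: times_divide_eq_right)
  have s1: "poly (Q_tilde B p q) (F1 B p q) > 0"
    unfolding F(1) by (intro pos quintic_root_one_sign x') (use y_bounds in linarith)+
  have s2: "poly (Q_tilde B p q) (F1 B p q + 10*p/(B^2*q^3)) < 0"
    unfolding F(2) by (intro neg quintic_root_one_sign x') (use y_bounds in linarith)+
  from poly_IVT_pos[OF _ s2 s1] show ?r1 using len by (auto simp: I1_def)
  have s3: "poly (Q_tilde B p q) (F2 B p q) > 0"
    unfolding F(3) by (intro pos, subst even[symmetric], intro quintic_root_one_sign x')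
      (use y_bounds in linarith)+
  have s4: "poly (Q_tilde B p q) (F2 B p q - 10*p/(B^2*q^3)) < 0"
    unfolding F(4) by (intro neg, subst even[symmetric], intro quintic_root_one_sign x')
      (use y_bounds in linarith)+
  from poly_IVT_neg[OF _ s3 s4] show ?r2 using len by (auto simp: I2_def)
  have s5: "poly (Q_tilde B p q) (F3 B p q) > 0"
    unfolding F(5) by (intro pos quintic_root_zero_sign x') (use y_bounds in linarith)+
  have s6: "poly (Q_tilde B p q) (F3 B p q + 32*p/(B^2*q^3)) < 0"
    unfolding F(6) by (intro neg quintic_root_zero_sign x') (use y_bounds in linarith)+
  from poly_IVT_pos[OF _ s6 s5] show ?r3 using len by (auto simp: I3_def)
  show ?r4
  proof -
    \<comment> \<open>A negative root \<open>- (r^2)\<close> of the quintic is a root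
      \<open>t = \<i> * r\<close> of the even polynomial. The points 0, \<open>q^2\<close>,
      \<open>3 * q^2\<close> correspond to \<open>s = 0\<close>, \<open>- (q^4)\<close>,
      \<open>- (9 * q^4)\<close>.\<close>
    define f where "f r = quintic P q (- (r^2))" for r
    have cont: "continuous_on A f" for A
      unfolding f_def quintic_def by (intro continuous_intros)
    have q4: "q^4 = P^4 * x^4" unfolding P(2) by (simp add: power_mult_distrib)
    have q0: "q^2 > 0" using q by simp
    have f0: "f 0 < 0" using P(1) q by (simp add: f_def quintic_def)
    have "f (q^2) = P^20 * quintic 1 x (- (x^4))"
      unfolding scale[symmetric] f_def by (simp add: q4 flip: power_mult)
    then have f1: "f (q^2) > 0" using quintic_negative_arguments(1)[OF x'(1,2)] P20 by simp
    have "f (3 * q^2) = P^20 * quintic 1 x (- (9 * x^4))"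
      unfolding scale[symmetric] f_def by (simp add: q4 power_mult_distrib mult.left_commute flip: power_mult)
    then have f2: "f (3 * q^2) < 0"
      using quintic_negative_arguments(2)[OF x'(1,2)] P20 by (simp add: mult_less_0_iff)
    obtain r where r: "0 \<le> r" "r \<le> q^2" "f r = 0"
      using IVT'[of f 0 0 "q^2"] f0 f1 q0 cont by auto
    obtain s where s: "q^2 \<le> s" "f s = 0"
      using IVT2'[of f "3 * q^2" 0 "q^2"] f1 f2 q0 cont by auto
    \<comment> \<open>The intermediate value theorem gives weak bounds only; the nonzero values at 0
      and \<open>q^2\<close> make them strict.\<close>
    have "r \<noteq> 0" "r \<noteq> q^2" "s \<noteq> q^2" using r s f0 f1 by auto
    then show ?r4 using r s unfolding f_def P_def[symmetric]
      by (intro exI[of _ r] exI[of _ s]) auto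
  qed
  \<comment> \<open>After division by \<open>P^2\<close> the three intervals lie near
    \<open>1 + 2*x\<close>, \<open>1 - 2*x\<close> and \<open>x\<close>, so 1 and 1/2 separate
    them.\<close>
  show ?r5
  proof (intro exI[of _ "P^2"] conjI)
    have "root_one x (- 5*w - 10*w^2 - 20*(2*w + w^2)*x) > 1"
      using root_one_bounds[OF x'(1), of "- 5*w - 10*w^2 - 20*(2*w + w^2)*x"] x y_bounds by linarith
    then have "F1 B p q + 10*p/(B^2*q^3) > P^2" unfolding F(2) using P2 by simp
    then show "I1 B p q \<subseteq> {P^2<..}" by (auto simp: I1_def)
    have "root_one (-x) (5*w + 20*(2*w + w^2)*x) > 1/2"
      using root_one_bounds[OF x'(3), of "5*w + 20*(2*w + w^2)*x"] x y_bounds by linarith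
    then have "F2 B p q > P^2 * (1/2)" unfolding F(3) using P2 by (intro mult_strict_left_mono)
    moreover have "root_one (-x) (- 5*w - 10*w^2 + 20*(2*w + w^2)*x) < 1"
      using root_one_bounds[OF x'(3), of "- 5*w - 10*w^2 + 20*(2*w + w^2)*x"] x y_bounds by linarith
    then have "F2 B p q - 10*p/(B^2*q^3) < P^2" unfolding F(4) using P2 by simp
    ultimately show "I2 B p q \<subseteq> {P^2/2<..<P^2}" by (auto simp: I2_def)
    have "root_zero x (16*w) < 1/2"
      using root_zero_bounds[OF x, of "16*w"] y_bounds by linarith
    then have "F3 B p q < P^2 * (1/2)" unfolding F(5) using P2 by (intro mult_strict_left_mono)
    moreover have "root_zero x (- 16*w - 32*w^2) > 0"
      using root_zero_bounds[OF x, of "- 16*w - 32*w^2"] y_bounds by linarith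
    then have "F3 B p q + 32*p/(B^2*q^3) > 0" unfolding F(6) using P2 by simp
    ultimately show "I3 B p q \<subseteq> {0<..<P^2/2}" by (auto simp: I3_def)
  qed (use P2 in auto)
qed

section \<open>Counting the roots and their orders\<close>

lemma root_condition_uminus: "root_condition t \<Longrightarrow> \<not> root_condition (- t)"
  by (auto simp: root_condition_def split: if_splits)

text \<open>The roots of an even polynomial come in pairs \<open>\<plusminus>t\<close>, of which at most one satisfies
  the root condition; so half as many such roots as the degree exhaust all roots, all simple.\<close>

lemma even_poly_root_condition:
  fixes Q :: "complex poly"
  assumes even: "\<And>t. poly Q (- t) = poly Q t" and "Q \<noteq> 0"
    and S: "finite S" "degree Q = 2 * card S" "\<And>t. t \<in> S \<Longrightarrow> poly Q t = 0"
      "\<And>t. t \<in> S \<Longrightarrow> root_condition t"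
  shows "{t. poly Q t = 0 \<and> root_condition t} = S" and "t \<in> S \<Longrightarrow> order t Q = 1"
proof -
  define Z where "Z = {t. poly Q t = 0}"
  have fin: "finite Z" unfolding Z_def using \<open>Q \<noteq> 0\<close> by (rule poly_roots_finite)
  have disj: "S \<inter> uminus ` S = {}" using S root_condition_uminus by fastforce
  have sub: "S \<union> uminus ` S \<subseteq> Z" using S even by (auto simp: Z_def)
  have card: "card (S \<union> uminus ` S) = degree Q"
    using S disj by (simp add: card_Un_disjoint card_image)
  have "card Z \<le> card (S \<union> uminus ` S)"
    unfolding card Z_def using \<open>Q \<noteq> 0\<close> by (rule card_poly_roots_bound)
  from card_seteq[OF fin sub this] have Z: "Z = S \<union> uminus ` S" ..
  show "{t. poly Q t = 0 \<and> root_condition t} = S"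
    using Z S root_condition_uminus unfolding Z_def by fastforce
  have pos: "order r Q \<ge> 1" if "r \<in> Z" for r
    using that \<open>Q \<noteq> 0\<close> order_root[of Q r] by (auto simp: Z_def)
  have "(\<Sum>r\<in>Z. order r Q) \<le> (\<Sum>r\<in>Z. 1)"
    using sum_order_le_degree[OF \<open>Q \<noteq> 0\<close>] card Z by (simp add: Z_def)
  then have "(\<Sum>r\<in>Z. order r Q) = (\<Sum>r\<in>Z. 1)"
    using sum_mono[of Z "\<lambda>_. 1" "\<lambda>r. order r Q"] pos by force
  then have "\<forall>r\<in>Z. order r Q = 1"
    using sum_mono_inv[of "\<lambda>_. 1" Z "\<lambda>r. order r Q"] pos fin by metis
  then show "t \<in> S \<Longrightarrow> order t Q = 1" using Z by blast
qed

theorem theorem6p1: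
  fixes B p q :: int
  assumes "B \<in> {1..9}"
    and "p < 0"
    and "q > 0"
    and "real_of_int q \<ge> 3600 * root 3 \<bar>real_of_int p\<bar>"
  defines "Q \<equiv> (Q_tilde (of_int B) (of_int p) (of_int q) :: complex poly)"
  defines "R \<equiv> {t :: complex. poly Q t = 0 \<and> root_condition t}"
  defines "J1 \<equiv> I1 (real_of_int B) (real_of_int p) (real_of_int q)"
  defines "J2 \<equiv> I2 (real_of_int B) (real_of_int p) (real_of_int q)"
  defines "J3 \<equiv> I3 (real_of_int B) (real_of_int p) (real_of_int q)"
  shows "card R = 5 \<and> (\<forall>t\<in>R. order t Q = 1) \<and>
    card {t \<in> R. t \<in> \<real> \<and> Re t > 0} = 3 \<and>
    (\<exists>t1 t2 t3 :: real. t1 \<in> J1 \<and> t2 \<in> J2 \<and> t3 \<in> J3 \<and>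
       {t \<in> R. t \<in> \<real> \<and> Re t > 0} = {complex_of_real t1, complex_of_real t2, complex_of_real t3}) \<and>
    J1 \<inter> J2 = {} \<and> J1 \<inter> J3 = {} \<and> J2 \<inter> J3 = {}"
proof -
  define b where "b = real_of_int B"
  define p' where "p' = real_of_int p"
  define q' where "q' = real_of_int q"
  define P where "P = b * q'^3 - p'"
  have b: "b \<ge> 1" using assms(1) by (simp add: b_def)
  have p: "p' \<le> -1" using assms(2) by (simp add: p'_def)
  have "(3600 * root 3 \<bar>p'\<bar>)^3 \<le> q'^3"
    using assms(4) unfolding p'_def q'_def by (intro power_mono) auto
  then have "3600^3 * \<bar>p'\<bar> \<le> q'^3" by (simp add: power_mult_distrib)
  \<comment> \<open>The cubed hypothesis is far stronger than this bound, which makes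
    \<open>w\<close> at most 1/1000.\<close>
  then have pq: "1000 * (- p') \<le> q'^3" using p by simp
  have "1 \<le> root 3 \<bar>p'\<bar>" using p by simp
  then have q: "q' \<ge> 3600" using assms(4) unfolding p'_def q'_def by linarith
  have ofr: "of_int B = complex_of_real b" "of_int p = complex_of_real p'"
    "of_int q = complex_of_real q'" by (simp_all add: b_def p'_def q'_def)
  have Q: "Q = Q_poly (of_real P) (of_real q')"
    by (simp add: Q_def Q_tilde_def ofr P_def)
  have Q_real: "poly Q (of_real t) = of_real (poly (Q_tilde b p' q') t)" for t
    using of_real_quintic[of P q' "t^2"]
    by (simp add: Q poly_Q_poly Q_tilde_def P_def)
  have Q_imag: "poly Q (\<i> * of_real r) = of_real (quintic P q' (- (r^2)))" for r
    using of_real_quintic[of P q' "- (r^2)"]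
    by (simp add: Q poly_Q_poly power_mult_distrib)
  note roots = Q_tilde_real_and_imaginary_roots[OF b p q pq]
  have J: "J1 = I1 b p' q'" "J2 = I2 b p' q'" "J3 = I3 b p' q'"
    by (simp_all add: J1_def J2_def J3_def b_def p'_def q'_def)
  obtain t1 t2 t3 where t: "t1 \<in> J1" "t2 \<in> J2" "t3 \<in> J3"
    "poly (Q_tilde b p' q') t1 = 0" "poly (Q_tilde b p' q') t2 = 0" "poly (Q_tilde b p' q') t3 = 0"
    using roots(1-3) unfolding J by blast
  obtain r s where rs: "0 < r" "r < s" "quintic P q' (- (r^2)) = 0" "quintic P q' (- (s^2)) = 0"
    using roots(4) unfolding P_def by blast
  obtain m where m: "m > 0" "J3 \<subseteq> {0<..<m/2}" "J2 \<subseteq> {m/2<..<m}" "J1 \<subseteq> {m<..}"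
    using roots(5) unfolding J by blast
  have ord: "0 < t3" "t3 < t2" "t2 < t1" using t m by fastforce+
  define T where "T = {complex_of_real t1, complex_of_real t2, complex_of_real t3}"
  define U where "U = {\<i> * complex_of_real r, \<i> * complex_of_real s}"
  have nonreal: "\<i> * complex_of_real a \<notin> \<real>" if "a > 0" for a
    using that by (simp add: complex_is_Real_iff)
  have T: "t \<in> \<real> \<and> Re t > 0" if "t \<in> T" for t using that ord by (auto simp: T_def)
  have U: "t \<notin> \<real> \<and> Im t > 0" if "t \<in> U" for t
    using that rs nonreal by (auto simp: U_def)
  have cT: "card T = 3" using ord by (simp add: T_def)
  have cU: "card U = 2" using rs by (simp add: U_def)
  have fin: "finite T" "finite U" by (simp_all add: T_def U_def)
  have cTU: "card (T \<union> U) = 5"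
    using card_Un_disjoint[OF fin] T U cT cU by fastforce
  have even: "poly Q (- t) = poly Q t" for t by (simp add: Q poly_Q_poly)
  have deg: "degree Q = 10" unfolding Q by (rule degree_Q_poly)
  have rts: "poly Q t = 0" if "t \<in> T \<union> U" for t
    using that t(4-6) rs(3,4) Q_real Q_imag by (auto simp: T_def U_def)
  have rc: "root_condition t" if "t \<in> T \<union> U" for t
    using that T U by (auto simp: root_condition_def)
  have "Q \<noteq> 0" using deg by auto
  \<comment> \<open>Three real and two imaginary roots are half of the degree 10, so they exhaust
    \<open>R\<close>.\<close>
  have R: "R = T \<union> U"
    unfolding R_def
    by (rule even_poly_root_condition) (use even \<open>Q \<noteq> 0\<close> fin deg cTU rts rc in auto)
  have simple: "order t Q = 1" if "t \<in> R" for t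
    by (rule even_poly_root_condition(2)[of Q "T \<union> U"])
      (use that R even \<open>Q \<noteq> 0\<close> fin deg cTU rts rc in auto)
  have real: "{t \<in> R. t \<in> \<real> \<and> Re t > 0} = T" using R T U by blast
  have disj: "J1 \<inter> J2 = {}" "J1 \<inter> J3 = {}" "J2 \<inter> J3 = {}"
    using m by fastforce+
  show ?thesis
    using R cTU simple cT disj t(1-3) unfolding real by (auto simp: T_def)
qed

end
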